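(* Let $p$ be an odd prime, let $s>e$ be positive integers, and let $\lambda$ be an odd integer such that both $\lambda$ and $\lambda+2$ lie strictly between $-p^e$ and $p^e$. Then $$I_s(\boldsymbol z;\lambda+2)\equiv K(\boldsymbol z;\lambda)\,I_s(\boldsymbol z;\lambda)\pmod{p^{s-e}}.$$
   Context: Let $\boldsymbol z=(z_1,z_2)$. For an odd integer $\lambda$ with $-p^s<\lambda<p^s$ put $$\Phi_s(t;\boldsymbol z;\lambda)=t^{(p^s-\lambda)/2}(t-z_1)^{(p^s-1)/2}(t-z_2)^{(p^s-1)/2}.$$ The column vector $I_s(\boldsymbol z;\lambda)=(I_{s,1}(\boldsymbol z;\lambda),I_{s,2}(\boldsymbol z;\lambda))$ has as $j$-th coordinate $I_{s,j}(\boldsymbol z;\lambda)\in\mathbb Z[z_1,z_2]$ the coefficient of $t^{p^s-1}$ in the polynomial $\Phi_s(t;\boldsymbol z;\lambda)/(t-z_j)$. The matrix is $$K(\boldsymbol z;\lambda)=\begin{bmatrix}\frac{\lambda+1}{z_1\lambda}&\frac{1}{z_1\lambda}\\[2pt] \frac{1}{z_2\lambda}&\frac{\lambda+1}{z_2\lambda}\end{bmatrix}.$$ Both sides of the congruence are vectors of Laurent polynomials in $z_1,z_2$ with rational coefficients ($\lambda$ may be divisible by $p$); the congruence modulo $p^{s-e}$ means that every coefficient of every coordinate of the difference of the two sides lies in $p^{s-e}\mathbb Z_{(p)}$, where $\mathbb Z_{(p)}\subset\mathbb Q$ is the ring of rational numbers with denominator prime to $p$. *)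

theory Defs
  imports
    "HOL-Analysis.Analysis"
    "HOL-Computational_Algebra.Computational_Algebra"
    "HOL-Library.Poly_Mapping"
begin

text \<open>
  The ring of integer polynomials in two variables is represented as \<open>int poly poly\<close>, where the
  inner variable is the first one and the outer variable the second one; polynomials in \<open>t\<close> over
  this ring have type \<open>int poly poly poly\<close>. The coefficient of the monomial with exponents
  \<open>a\<close> (first variable) and \<open>b\<close> (second variable) in \<open>P\<close> is thus \<open>coeff (coeff P b) a\<close>.
\<close>

definition z :: "(int poly poly) ^ 2" where
  "z = vector [[:[:0, 1:]:], [:0, 1:]]"

definition Phi :: "nat \<Rightarrow> nat \<Rightarrow> int \<Rightarrow> int poly poly poly" where
  "Phi p s l =
     [:0, 1:] ^ nat ((int p ^ s - l) div 2)
     * [:- (z $ 1), 1:] ^ ((p ^ s - 1) div 2)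
     * [:- (z $ 2), 1:] ^ ((p ^ s - 1) div 2)"

definition I_vec :: "nat \<Rightarrow> nat \<Rightarrow> int \<Rightarrow> (int poly poly) ^ 2" where
  "I_vec p s l = (\<chi> j. coeff (Phi p s l div [:- (z $ j), 1:]) (p ^ s - 1))"

text \<open>The division in \<^const>\<open>I_vec\<close> is exact in the relevant range.\<close>

lemma Phi_div_exact:
  assumes "p > 2" "s > 0"
  shows "[:- (z $ j), 1:] * (Phi p s l div [:- (z $ j), 1:]) = Phi p s l"
proof -
  have "p ^ 1 \<le> p ^ s" using assms by (intro power_increasing) auto
  then have "(p ^ s - 1) div 2 \<noteq> 0" using assms by simp
  then have d: "x dvd x ^ ((p ^ s - 1) div 2)" for x :: "int poly poly poly"
    by (intro dvd_power) auto
  have "j = 1 \<or> j = 2" using exhaust_2 by blast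
  then have "[:- (z $ j), 1:] dvd Phi p s l"
    unfolding Phi_def using d by (auto intro: dvd_mult dvd_mult2)
  then show ?thesis by (rule dvd_mult_div_cancel)
qed

text \<open>
  Laurent polynomials in two variables over the rationals, as the group algebra of
  \<open>int \<times> int\<close>: the monomial with exponents \<open>a\<close> and \<open>b\<close> and coefficient \<open>c\<close> is
  \<open>Poly_Mapping.single (a, b) c\<close>, and multiplication is convolution.
\<close>

type_synonym laurent = "(int \<times> int) \<Rightarrow>\<^sub>0 rat"

definition laurent_of :: "int poly poly \<Rightarrow> laurent" where
  "laurent_of P =
     (\<Sum>b\<le>degree P. \<Sum>a\<le>degree (coeff P b).
        Poly_Mapping.single (int a, int b) (of_int (coeff (coeff P b) a)))"

lemma lookup_laurent_of:
  "Poly_Mapping.lookup (laurent_of P) (u, v) =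
     (if u \<ge> 0 \<and> v \<ge> 0 then of_int (coeff (coeff P (nat v)) (nat u)) else 0)"
proof (cases "u \<ge> 0 \<and> v \<ge> 0")
  case True
  then obtain m n where [simp]: "u = int m" "v = int n" by (metis nonneg_int_cases)
  have "Poly_Mapping.lookup (laurent_of P) (u, v) =
      (\<Sum>b\<le>degree P. \<Sum>a\<le>degree (coeff P b).
         if a = m then (if b = n then of_int (coeff (coeff P b) a) else 0) else 0)"
    unfolding laurent_of_def lookup_sum
    by (intro sum.cong refl) (auto simp: lookup_single when_def)
  also have "\<dots> = (\<Sum>b\<le>degree P. if b = n then of_int (coeff (coeff P b) m) else 0)"
    by (intro sum.cong refl) (auto simp: coeff_eq_0)
  also have "\<dots> = of_int (coeff (coeff P n) m)"
    by (auto simp: coeff_eq_0)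
  finally show ?thesis by simp
next
  case False
  then show ?thesis
    unfolding laurent_of_def lookup_sum
    by (auto simp: lookup_single when_def intro!: sum.neutral)
qed

definition K_mat :: "int \<Rightarrow> laurent ^ 2 ^ 2" where
  "K_mat l = vector
     [vector [Poly_Mapping.single (-1, 0) (of_int (l + 1) / of_int l),
              Poly_Mapping.single (-1, 0) (1 / of_int l)],
      vector [Poly_Mapping.single (0, -1) (1 / of_int l),
              Poly_Mapping.single (0, -1) (of_int (l + 1) / of_int l)]]"

definition Z_loc :: "nat \<Rightarrow> rat set" where
  "Z_loc p = {of_int a / of_int b | a b :: int. coprime b (int p)}"

definition laurent_vec_cong :: "nat \<Rightarrow> nat \<Rightarrow> laurent ^ 2 \<Rightarrow> laurent ^ 2 \<Rightarrow> bool" where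
  "laurent_vec_cong p k F G \<longleftrightarrow>
     (\<forall>j m. Poly_Mapping.lookup ((F - G) $ j) m \<in> (\<lambda>x. of_nat p ^ k * x) ` Z_loc p)"

end

theory Submission
  imports Defs
begin

text \<open>
  Write \<open>q = p^s\<close>, \<open>N = (q - 1)/2\<close>, \<open>F = (t - z\<^sub>1)^N (t - z\<^sub>2)^N\<close> and \<open>A\<^sub>j = F / (t - z\<^sub>j)\<close>. The
  parameter \<open>\<lambda>\<close> enters \<open>I\<^sub>s\<close> only through the power of \<open>t\<close>, so with \<open>n = (q - 2 + \<lambda>)/2\<close> the \<open>j\<close>-th
  coordinates of \<open>I\<^sub>s(\<lambda>)\<close> and \<open>I\<^sub>s(\<lambda> + 2)\<close> are the coefficients \<open>a\<^sub>j(n)\<close> and \<open>a\<^sub>j(n + 1)\<close> of the same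
  polynomial \<open>A\<^sub>j\<close>: raising \<open>\<lambda>\<close> by 2 moves to the next coefficient.

  Consecutive coefficients are related by computing the coefficient of \<open>t^n\<close> in \<open>F'\<close> twice. From
  \<open>F' = N (A\<^sub>1 + A\<^sub>2)\<close> it is \<open>N (a\<^sub>1(n) + a\<^sub>2(n))\<close>; from \<open>F = (t - z\<^sub>j) A\<^sub>j\<close> it is
  \<open>(n + 1) (a\<^sub>j(n) - z\<^sub>j a\<^sub>j(n + 1))\<close>. Here \<open>2 N = q - 1\<close> and \<open>2 (n + 1) = q + \<lambda>\<close>, so doubling
  the resulting relation shows that \<open>\<lambda> z\<^sub>j a\<^sub>j(n + 1)\<close> and \<open>(\<lambda> + 1) a\<^sub>j(n) + a\<^sub>i(n)\<close>, where \<open>i \<noteq> j\<close>, are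
  congruent modulo \<open>q\<close> as integer polynomials (lemma \<open>scaled_congruence\<close>). Dividing by \<open>\<lambda> z\<^sub>j\<close> gives the
  claim: since \<open>0 < \<bar>\<lambda>\<bar> < p^e\<close>, the division by \<open>\<lambda>\<close> costs fewer than \<open>e\<close> powers of \<open>p\<close>
  (lemma \<open>prime_power_div_in_Z_loc\<close>).
\<close>

section \<open>Consecutive coefficients of products of powers of linear factors\<close>

lemma coeff_linear_mult:
  fixes x :: "'a :: comm_ring_1"
  shows "coeff ([:- x, 1:] * A) (Suc n) = coeff A n - x * coeff A (Suc n)"
  by simp

text \<open>
  The two sides are the coefficient of \<open>t^n\<close> in the derivative of \<open>((t - x) (t - y))^N\<close>, obtained
  on the left from the factorization with \<open>t - x\<close> split off, on the right from the product rule.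
\<close>
lemma coeff_recurrence:
  fixes x y :: "'a :: idom"
  assumes "N > 0"
  defines "A \<equiv> [:- x, 1:] ^ (N - 1) * [:- y, 1:] ^ N"
    and "B \<equiv> [:- y, 1:] ^ (N - 1) * [:- x, 1:] ^ N"
  shows "of_nat (Suc n) * (coeff A n - x * coeff A (Suc n)) = of_nat N * (coeff A n + coeff B n)"
proof -
  obtain k where N: "N = Suc k" using assms(1) by (cases N) auto
  define F where "F = [:- x, 1:] * A"
  have "F = [:- x, 1:] ^ Suc k * [:- y, 1:] ^ Suc k"
    by (simp add: F_def A_def N mult_ac del: mult_pCons_left mult_pCons_right)
  then have "pderiv F = smult (of_nat N) (A + B)"
    unfolding A_def B_def N
    by (simp add: pderiv_mult pderiv_power_Suc pderiv_pCons one_pCons[symmetric] smult_add_right mult_ac add.commute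
        del: mult_pCons_left mult_pCons_right of_nat_Suc power_Suc)
  then have "coeff (pderiv F) n = of_nat N * (coeff A n + coeff B n)" by simp
  moreover have "coeff (pderiv F) n = of_nat (Suc n) * (coeff A n - x * coeff A (Suc n))"
    unfolding F_def coeff_pderiv coeff_linear_mult ..
  ultimately show ?thesis by simp
qed

section \<open>The integral congruence modulo the full prime power\<close>

text \<open>The power of \<open>t\<close> in \<open>Phi\<close> only shifts the index of the coefficient that is extracted.\<close>
lemma I_vec_coeff:
  fixes p s :: nat and l :: int
  assumes "N > 0" "p ^ s = 2 * N + 1" "l = 2 * int n + 1 - 2 * int N" "n \<le> 2 * N"
  shows "I_vec p s l $ 1 = coeff ([:- (z $ 1), 1:] ^ (N - 1) * [:- (z $ 2), 1:] ^ N) n"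
    and "I_vec p s l $ 2 = coeff ([:- (z $ 2), 1:] ^ (N - 1) * [:- (z $ 1), 1:] ^ N) n"
proof -
  have "int p ^ s = 2 * int N + 1" using assms(2) by (metis of_nat_Suc of_nat_mult of_nat_numeral
      of_nat_power Suc_eq_plus1 add.commute)
  then have M: "nat ((int p ^ s - l) div 2) = 2 * N - n" using assms(3,4) by simp
  have N: "(p ^ s - 1) div 2 = N" using assms(2) by simp
  obtain k where k: "N = Suc k" using assms(1) by (cases N) auto
  have t: "[:0, 1:] ^ i = (monom 1 i :: int poly poly poly)" for i by (simp add: monom_altdef)
  have shift: "coeff (monom 1 (2 * N - n) * A) (p ^ s - 1) = coeff A n"
    for A :: "int poly poly poly"
    using assms(2,4) by (simp add: coeff_monom_mult)
  have quotient: "(c * B) div c = B" if "c \<noteq> 0" for B c :: "int poly poly poly"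
    using that by simp
  have "Phi p s l = [:- (z $ 1), 1:] * (monom 1 (2 * N - n) *
      ([:- (z $ 1), 1:] ^ (N - 1) * [:- (z $ 2), 1:] ^ N))"
    unfolding Phi_def M N t
    by (simp add: k mult_ac del: mult_pCons_left mult_pCons_right)
  then show "I_vec p s l $ 1 = coeff ([:- (z $ 1), 1:] ^ (N - 1) * [:- (z $ 2), 1:] ^ N) n"
    unfolding I_vec_def by (simp only: vec_lambda_beta) (subst quotient, simp, simp only: shift)
  have "Phi p s l = [:- (z $ 2), 1:] * (monom 1 (2 * N - n) *
      ([:- (z $ 2), 1:] ^ (N - 1) * [:- (z $ 1), 1:] ^ N))"
    unfolding Phi_def M N t
    by (simp add: k mult_ac del: mult_pCons_left mult_pCons_right)
  then show "I_vec p s l $ 2 = coeff ([:- (z $ 2), 1:] ^ (N - 1) * [:- (z $ 1), 1:] ^ N) n"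
    unfolding I_vec_def by (simp only: vec_lambda_beta) (subst quotient, simp, simp only: shift)
qed

text \<open>
  Twice \<open>coeff_recurrence\<close>, with the multiples of \<open>q = 2 N + 1\<close> collected on the right: they arise
  from \<open>2 (n + 1) = q + l\<close> and \<open>2 N = q - 1\<close>. All that matters about the cofactor of \<open>q\<close> is that its
  coefficients are integers.
\<close>
lemma doubled_recurrence:
  fixes x y :: "int poly poly"
  assumes "N > 0" "l = 2 * int n + 1 - 2 * int N"
  defines "A \<equiv> [:- x, 1:] ^ (N - 1) * [:- y, 1:] ^ N"
    and "B \<equiv> [:- y, 1:] ^ (N - 1) * [:- x, 1:] ^ N"
  shows "of_int l * (x * coeff A (Suc n)) - of_int (l + 1) * coeff A n - coeff B n
       = of_int (2 * int N + 1) * - (x * coeff A (Suc n) + coeff B n)"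
proof -
  have "of_nat (Suc n) * (coeff A n - x * coeff A (Suc n)) = of_nat N * (coeff A n + coeff B n)"
    unfolding A_def B_def by (rule coeff_recurrence) fact
  then have "(1 + of_nat n) * (coeff A n - x * coeff A (Suc n))
      = of_nat N * (coeff A n + coeff B n)" by simp
  moreover have "(of_int l :: int poly poly) = 2 * of_nat n + 1 - 2 * of_nat N"
    using assms(2) by simp
  ultimately show ?thesis
    by (simp only: of_int_add of_int_mult of_int_of_nat_eq of_int_numeral of_int_1) algebra
qed

lemma scaled_congruence:
  fixes p s :: nat and l :: int and i j :: 2
  assumes "odd p" "p > 2" "s > 0" "odd l" "- (int p ^ s) < l" "l + 2 < int p ^ s" "i \<noteq> j"
  obtains D where "of_int l * (z $ j * I_vec p s (l + 2) $ j)
      - of_int (l + 1) * I_vec p s l $ j - I_vec p s l $ i = of_int (int p ^ s) * D"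
proof -
  obtain N where N: "p ^ s = 2 * N + 1" using assms(1) by (metis oddE even_power)
  have "1 < p ^ s" using assms(2,3) by (intro one_less_power) auto
  then have "N > 0" using N by simp
  have q: "int p ^ s = 2 * int N + 1" using N by (metis of_nat_Suc of_nat_mult of_nat_numeral
      of_nat_power Suc_eq_plus1 add.commute)
  obtain m where m: "l = 2 * m + 1" using assms(4) by (elim oddE)
  have "m + int N \<ge> 0" using m assms(5) q by linarith
  then obtain n where n: "m + int N = int n" using nonneg_int_cases by blast
  have l: "l = 2 * int n + 1 - 2 * int N" using m n by simp
  have l2: "l + 2 = 2 * int (Suc n) + 1 - 2 * int N" using l by simp
  have "Suc n \<le> 2 * N" using l2 assms(6)[unfolded q] by simp
  then have "n \<le> 2 * N" by simp
  note coeffs = I_vec_coeff[OF \<open>N > 0\<close> N l \<open>n \<le> 2 * N\<close>]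
    I_vec_coeff[OF \<open>N > 0\<close> N l2 \<open>Suc n \<le> 2 * N\<close>]
  have "i = 1 \<and> j = 2 \<or> i = 2 \<and> j = 1" using assms(7) exhaust_2 by metis
  then show ?thesis
  proof
    assume "i = 1 \<and> j = 2"
    then show ?thesis
      using doubled_recurrence[OF \<open>N > 0\<close> l, of "z $ 2" "z $ 1"]
      by (intro that) (simp only: coeffs q)
  next
    assume "i = 2 \<and> j = 1"
    then show ?thesis
      using doubled_recurrence[OF \<open>N > 0\<close> l, of "z $ 1" "z $ 2"]
      by (intro that) (simp only: coeffs q)
  qed
qed

section \<open>Coefficients of Laurent polynomials\<close>

lemma lookup_single_mult:
  fixes f :: "'a :: group_add \<Rightarrow>\<^sub>0 'b :: semiring_0"
  shows "Poly_Mapping.lookup (Poly_Mapping.single k c * f) m = c * Poly_Mapping.lookup f (- k + m)"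
proof -
  have "Poly_Mapping.lookup (Poly_Mapping.single k c * f) m =
      (\<Sum>r. c * (\<Sum>q. Poly_Mapping.lookup f q when m = k + q) when r = k)"
    unfolding lookup_mult lookup_single
    by (intro Sum_any.cong) (auto simp: when_def)
  also have "\<dots> = c * (\<Sum>q. Poly_Mapping.lookup f q when m = k + q)" by simp
  also have "(\<Sum>q. Poly_Mapping.lookup f q when m = k + q)
      = (\<Sum>q. Poly_Mapping.lookup f q when q = - k + m)"
    by (intro Sum_any.cong) (auto simp: when_def add.assoc[symmetric])
  finally show ?thesis by simp
qed

lemma lookup_laurent_of_diff:
  "Poly_Mapping.lookup (laurent_of (P - Q)) m =
     Poly_Mapping.lookup (laurent_of P) m - Poly_Mapping.lookup (laurent_of Q) m"
  by (cases m) (simp add: lookup_laurent_of)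

lemma lookup_laurent_of_of_int_mult:
  "Poly_Mapping.lookup (laurent_of (of_int c * P)) m = of_int c * Poly_Mapping.lookup (laurent_of P) m"
  by (cases m) (simp add: lookup_laurent_of of_int_poly)

definition var_exponent :: "2 \<Rightarrow> int \<times> int" where
  "var_exponent j = (if j = 1 then (1, 0) else (0, 1))"

lemma lookup_laurent_of_var_mult:
  "Poly_Mapping.lookup (laurent_of (z $ j * P)) (var_exponent j + m) =
     Poly_Mapping.lookup (laurent_of P) m"
proof -
  obtain u v where m: "m = (u, v)" by (cases m)
  (* At an exponent 0 the shifted coefficient lies on the constant term of a multiple of the
     variable, which vanishes just as the coefficient at -1 does. *)
  have inner: "coeff ([:0, 1:] * c) (nat (w + 1)) = (if w \<ge> 0 then coeff c (nat w) else 0)"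
    if "w + 1 \<ge> 0" for w and c :: "'a :: comm_ring_1 poly"
  proof (cases "w \<ge> 0")
    case True
    then show ?thesis by (simp add: nat_add_distrib)
  next
    case False
    then have "w + 1 = 0" using that by simp
    then show ?thesis using False by simp
  qed
  have "j = 1 \<or> j = 2" by (rule exhaust_2)
  then show ?thesis
  proof
    assume j: "j = 1"
    show ?thesis
      using inner[of u "coeff P (nat v)"]
      by (auto simp: j m z_def var_exponent_def lookup_laurent_of add.commute)
  next
    assume j: "j = 2"
    show ?thesis
      using inner[of v P]
      by (auto simp: j m z_def var_exponent_def lookup_laurent_of add.commute)
  qed
qed

lemma lookup_K_mat_mult:
  assumes "i \<noteq> j"
  shows "Poly_Mapping.lookup ((K_mat l *v v) $ j) m =
    (of_int (l + 1) * Poly_Mapping.lookup (v $ j) (var_exponent j + m)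
      + Poly_Mapping.lookup (v $ i) (var_exponent j + m)) / of_int l"
proof -
  have "i = 1 \<and> j = 2 \<or> i = 2 \<and> j = 1" using assms exhaust_2 by metis
  then show ?thesis
    by (auto simp: K_mat_def matrix_vector_mult_def sum_2 lookup_add lookup_single_mult
        var_exponent_def add_divide_distrib distrib_right)
qed

section \<open>Division by a small integer\<close>

lemma prime_power_div_in_Z_loc:
  fixes p s e :: nat and l c :: int
  assumes "prime p" "e \<le> s" "l \<noteq> 0" "\<bar>l\<bar> < int p ^ e"
  shows "of_int (int p ^ s * c) / of_int l \<in> (\<lambda>x. of_nat p ^ (s - e) * x) ` Z_loc p"
proof -
  have p: "prime (int p)" using assms(1) by simp
  define k where "k = multiplicity (int p) l"
  obtain b where b: "l = int p ^ k * b" "\<not> int p dvd b"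
    using multiplicity_decompose'[of l "int p"] p assms(3) unfolding k_def
    by (metis not_prime_unit)
  have "int p ^ k \<le> \<bar>l\<bar>"
    using dvd_imp_le_int[of l "int p ^ k"] assms(3) b(1) by simp
  then have "int p ^ k < int p ^ e" using assms(4) by simp
  then have "k < e" by (rule power_less_imp_less_exp[OF prime_gt_1_int[OF p]])
  have "coprime b (int p)" using prime_imp_coprime[OF p b(2)] by (simp only: coprime_commute)
  then have "of_int (int p ^ (e - k) * c) / of_int b \<in> Z_loc p" unfolding Z_loc_def by blast
  moreover have "of_int (int p ^ s * c) / of_int l
      = (of_nat p ^ (s - e) * (of_int (int p ^ (e - k) * c) / of_int b) :: rat)"
  proof -
    have "s = (s - e) + (e - k) + k" using \<open>k < e\<close> assms(2) by simp
    then have "int p ^ s = int p ^ (s - e) * int p ^ (e - k) * int p ^ k"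
      by (simp only: power_add[symmetric])
    then have "of_int (int p ^ s * c) = (of_nat p ^ (s - e) * of_int (int p ^ (e - k) * c)
        * of_nat p ^ k :: rat)"
      by simp
    moreover have "of_nat p ^ k \<noteq> (0 :: rat)" using assms(1) by auto
    moreover have "of_int l = (of_nat p ^ k * of_int b :: rat)" by (simp add: b(1))
    ultimately show ?thesis by (simp del: of_int_mult)
  qed
  ultimately show ?thesis by blast
qed

section \<open>The congruence of Laurent polynomials\<close>

theorem theorem3p2:
  fixes p s e :: nat and l :: int
  assumes "prime p" and "odd p"
    and "0 < e" and "e < s"
    and "odd l"
    and "- (int p ^ e) < l" and "l < int p ^ e"
    and "- (int p ^ e) < l + 2" and "l + 2 < int p ^ e"
  shows "laurent_vec_cong p (s - e)
           (\<chi> j. laurent_of (I_vec p s (l + 2) $ j))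
           (K_mat l *v (\<chi> j. laurent_of (I_vec p s l $ j)))"
  unfolding laurent_vec_cong_def
proof (intro allI)
  fix j :: 2 and m :: "int \<times> int"
  let ?L = "\<lambda>P. Poly_Mapping.lookup (laurent_of P)"
  let ?F = "\<chi> j. laurent_of (I_vec p s (l + 2) $ j)"
  let ?G = "K_mat l *v (\<chi> j. laurent_of (I_vec p s l $ j))"
  obtain i :: 2 where ij: "i \<noteq> j" by (metis zero_neq_one)
  have "p > 2" using assms(1,2) prime_ge_2_nat[of p] by (cases "p = 2") auto
  have "int p ^ e \<le> int p ^ s" using \<open>p > 2\<close> assms(4) by (intro power_increasing) auto
  then have bounds: "- (int p ^ s) < l" "l + 2 < int p ^ s" using assms(6,9) by simp_all
  have "s > 0" using assms(4) by simp
  from scaled_congruence[OF assms(2) \<open>p > 2\<close> this assms(5) bounds ij]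
  obtain D where D: "of_int l * (z $ j * I_vec p s (l + 2) $ j)
      - of_int (l + 1) * I_vec p s l $ j - I_vec p s l $ i = of_int (int p ^ s) * D" .
  have "l \<noteq> 0" using assms(5) by auto
  let ?n = "var_exponent j + m"
  (* The K_mat entries carry the inverse variable, so the coefficient of the difference at m is
     read off from the cleared identity D one step further in the direction of that variable. *)
  have "Poly_Mapping.lookup ((?F - ?G) $ j) m = ?L (I_vec p s (l + 2) $ j) m
      - (of_int (l + 1) * ?L (I_vec p s l $ j) ?n + ?L (I_vec p s l $ i) ?n) / of_int l"
    by (simp add: lookup_minus lookup_K_mat_mult[OF ij])
  also have "\<dots> = (of_int l * ?L (z $ j * I_vec p s (l + 2) $ j) ?n
      - of_int (l + 1) * ?L (I_vec p s l $ j) ?n - ?L (I_vec p s l $ i) ?n) / of_int l"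
    using \<open>l \<noteq> 0\<close> by (simp only: lookup_laurent_of_var_mult) (simp add: field_simps)
  also have "\<dots> = of_int (int p ^ s) * ?L D ?n / of_int l"
    by (simp only: lookup_laurent_of_diff[symmetric] lookup_laurent_of_of_int_mult[symmetric] D)
  finally have eq: "Poly_Mapping.lookup ((?F - ?G) $ j) m
      = of_int (int p ^ s) * ?L D ?n / of_int l" .
  obtain c where "?L D ?n = of_int c"
    by (cases ?n) (metis lookup_laurent_of of_int_0)
  moreover have "\<bar>l\<bar> < int p ^ e" using assms(6,7) by simp
  ultimately show "Poly_Mapping.lookup ((?F - ?G) $ j) m
      \<in> (\<lambda>x. of_nat p ^ (s - e) * x) ` Z_loc p"
    using prime_power_div_in_Z_loc[OF assms(1) less_imp_le[OF assms(4)] \<open>l \<noteq> 0\<close>, of c]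
    by (simp only: eq of_int_mult)
qed

end
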